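(* Let $r,\kappa_1,\kappa_2,\kappa_3$ be positive integers, let $\pi_1,\dots,\pi_r$ be nonzero real numbers, and for $i\in\{1,2,3\}$ and $j\in\{1,\dots,r\}$ let $\mathbf{x}_{ij}\in\mathbb{R}^{\kappa_i}$. Write $\mathbf{X}_i=(\mathbf{x}_{i1},\dots,\mathbf{x}_{ir})$, let $$\mathbb{X}=\sum_{j=1}^r\pi_j\,(\mathbf{x}_{1j}\otimes\mathbf{x}_{2j}\otimes\mathbf{x}_{3j}),$$ and for $1\le i_1<i_2\le 3$ let $$\mathbb{X}_{\{i_1,i_2\}}=\sum_{j=1}^r\pi_j\,(\mathbf{x}_{i_1j}\otimes\mathbf{x}_{i_2j}).$$ If $\mathbf{X}_1,\mathbf{X}_2,\mathbf{X}_3$ all have full column rank (rank $r$) and $\mathbb{X}_{\{i_1,i_2\}}$ is observable for each pair $i_1<i_2$ in $\{1,2,3\}$ (in addition to $\mathbb{X}$ and $r$), then $\mathbf{X}_1,\mathbf{X}_2,\mathbf{X}_3$ are all identified up to a common permutation of their columns. Explicitly: under these rank conditions, if $\pi'_1,\dots,\pi'_r$ are nonzero reals and $\mathbf{x}'_{ij}\in\mathbb{R}^{\kappa_i}$ are vectors with $\sum_{j}\pi'_j(\mathbf{x}'_{1j}\otimes\mathbf{x}'_{2j}\otimes\mathbf{x}'_{3j})=\mathbb{X}$ and $\sum_j\pi'_j(\mathbf{x}'_{i_1j}\otimes\mathbf{x}'_{i_2j})=\mathbb{X}_{\{i_1,i_2\}}$ for all $1\le i_1<i_2\le3$, then there is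 a single $r\times r$ permutation matrix $\mathbf{P}$ such that $(\mathbf{x}'_{i1},\dots,\mathbf{x}'_{ir})=\mathbf{X}_i\mathbf{P}$ for $i=1,2,3$.
   Context: $\otimes$ denotes the outer (tensor) product: $\mathbf{a}\otimes\mathbf{b}\otimes\mathbf{c}$ is the three-way array with entries $a_kb_lc_m$, and $\mathbf{a}\otimes\mathbf{b}$ is the matrix $\mathbf{a}\mathbf{b}^\prime$. The integer $r$ is known. A quantity is "observable" if its value is known in addition to $\mathbb{X}$. A parameter is "identified up to a permutation" if it is determined, up to a permutation of its columns, by the observable arrays and $r$; i.e. any $r$-term decomposition with nonzero weights generating the same observable arrays has the same value of that parameter up to a permutation of its columns. *)

theory Defs
  imports "HOL-Analysis.Analysis"
begin

definition outer2 :: "real^'a \<Rightarrow> real^'b \<Rightarrow> real^'b^'a" where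
  "outer2 a b = (\<chi> k l. a $ k * b $ l)"

definition outer3 :: "real^'a \<Rightarrow> real^'b \<Rightarrow> real^'c \<Rightarrow> real^'c^'b^'a" where
  "outer3 a b c = (\<chi> k l m. a $ k * b $ l * c $ m)"

text \<open>
  A decomposition with \<open>CARD('r)\<close> terms is given by its weights \<open>w\<close> and by matrices whose
  \<open>j\<close>-th columns are the vectors of the \<open>j\<close>-th term.
\<close>

definition two_way_array ::
    "('r::finite \<Rightarrow> real) \<Rightarrow> real^'r^'a \<Rightarrow> real^'r^'b \<Rightarrow> real^'b^'a" where
  "two_way_array w A B = (\<Sum>j\<in>UNIV. w j *\<^sub>R outer2 (column j A) (column j B))"

definition three_way_array ::
    "('r::finite \<Rightarrow> real) \<Rightarrow> real^'r^'a \<Rightarrow> real^'r^'b \<Rightarrow> real^'r^'c \<Rightarrow> real^'c^'b^'a" where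
  "three_way_array w A B C =
     (\<Sum>j\<in>UNIV. w j *\<^sub>R outer3 (column j A) (column j B) (column j C))"

definition permutation_matrix :: "real^'r^'r \<Rightarrow> bool" where
  "permutation_matrix P \<longleftrightarrow>
     (\<exists>p. p permutes UNIV \<and> P = (\<chi> i j. if i = p j then 1 else 0))"

end

theory Submission
  imports Defs
begin

text \<open>
  Let \<open>S\<^sub>i = L\<^sub>i ** X\<^sub>i'\<close> for left inverses \<open>L\<^sub>i\<close> of the \<open>X\<^sub>i\<close>, and let \<open>W\<close>, \<open>W'\<close> be the diagonal
  matrices of weights. The two-way arrays give \<open>S\<^sub>i ** W' ** transpose S\<^sub>k = W\<close> for \<open>i \<noteq> k\<close>, and
  since all factors are invertible, \<open>S\<^sub>1 = S\<^sub>2 = S\<^sub>3 = S\<close> and \<open>X\<^sub>i' = X\<^sub>i ** S\<close>. Contracting the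
  three-way array with the \<open>L\<^sub>i\<close> and cancelling \<open>S ** W'\<close> shows that any two rows of \<open>S\<close> have
  entrywise product zero and that every entry is idempotent; as \<open>S\<close> has no zero row, it is a
  permutation matrix.
\<close>

definition diagonal :: "('r::finite \<Rightarrow> real) \<Rightarrow> real^'r^'r" where
  "diagonal w = (\<chi> i j. if i = j then w i else 0)"

lemma matrix_mult_diagonal_nth: "(A ** diagonal w) $ i $ j = A $ i $ j * w j"
  by (simp add: matrix_matrix_mult_def diagonal_def if_distrib[of "\<lambda>x. _ * x"]
      cong: if_cong)

lemma diagonal_inverse:
  assumes "\<And>j. w j \<noteq> 0"
  shows "diagonal w ** diagonal (\<lambda>j. inverse (w j)) = mat 1"
  by (simp add: vec_eq_iff matrix_mult_diagonal_nth) (simp add: diagonal_def mat_def assms)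

lemma invertible_diagonal:
  assumes "\<And>j. w j \<noteq> 0"
  shows "invertible (diagonal w)"
  unfolding invertible_right_inverse by (rule exI, rule diagonal_inverse, rule assms)

lemma invertible_factors:
  fixes A B :: "real^'n^'n"
  assumes "invertible (A ** B)"
  shows "invertible A" "invertible B"
  using assms by (simp_all add: invertible_det_nz det_mul)

lemma invertible_mult_right_cancel:
  fixes B :: "real^'n^'n" and A A' :: "real^'n^'m"
  assumes "invertible B" "A ** B = A' ** B"
  shows "A = A'"
proof -
  obtain C where "B ** C = mat 1"
    using assms(1) unfolding invertible_def by blast
  moreover have "(A ** B) ** C = (A' ** B) ** C"
    using assms(2) by simp
  ultimately show ?thesis
    by (simp add: matrix_mul_assoc[symmetric])
qed

lemma full_column_rank_left_inverse:
  fixes A :: "real^'r^'k"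
  assumes "rank A = CARD('r)"
  obtains L where "L ** A = mat 1"
proof -
  have "inj ((*v) A)"
    using assms by (simp add: full_rank_injective)
  then show thesis
    using that by (auto simp flip: matrix_left_invertible_injective)
qed

lemma two_way_array_nth:
  "two_way_array w A B $ k $ l = (\<Sum>j\<in>UNIV. w j * A $ k $ j * B $ l $ j)"
  by (simp add: two_way_array_def outer2_def column_def mult.assoc)

lemma three_way_array_nth:
  "three_way_array w A B C $ k $ l $ m = (\<Sum>j\<in>UNIV. w j * A $ k $ j * B $ l $ j * C $ m $ j)"
  by (simp add: three_way_array_def outer3_def column_def mult.assoc)

lemma two_way_array_eq_matrix_mult:
  "two_way_array w A B = A ** diagonal w ** transpose B"
  by (simp add: vec_eq_iff two_way_array_nth matrix_matrix_mult_def[of "A ** diagonal w"]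
      matrix_mult_diagonal_nth transpose_def mult.commute)

lemma two_way_array_commute:
  "two_way_array w B A = transpose (two_way_array w A B)"
  by (simp add: vec_eq_iff two_way_array_nth transpose_def mult.assoc mult.commute[of "B $ _ $ _"])

lemma sum_product3:
  fixes f :: "'a \<Rightarrow> 'd::semiring_0"
  shows "(\<Sum>a\<in>A. f a) * ((\<Sum>b\<in>B. g b) * (\<Sum>c\<in>C. h c)) =
    (\<Sum>a\<in>A. \<Sum>b\<in>B. \<Sum>c\<in>C. f a * (g b * h c))"
  unfolding sum_product[of g B h C] unfolding sum_distrib_right unfolding sum_distrib_left ..

text \<open>Multilinearity of the outer product: the right-hand side depends on \<open>A\<close>,
  \<open>B\<close>, \<open>C\<close> and \<open>w\<close> only through their array. Hence two
  decompositions of one array still give equal arrays after multiplication by left inverses.\<close>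

lemma three_way_array_matrix_mult:
  fixes A :: "real^'r^'a" and B :: "real^'r^'b" and C :: "real^'r^'c"
  shows "three_way_array w (L ** A) (M ** B) (N ** C) $ i $ k $ h =
    (\<Sum>a\<in>UNIV. \<Sum>b\<in>UNIV. \<Sum>c\<in>UNIV.
       L $ i $ a * M $ k $ b * N $ h $ c * three_way_array w A B C $ a $ b $ c)"
proof -
  have "w j * (L ** A) $ i $ j * (M ** B) $ k $ j * (N ** C) $ h $ j =
      (\<Sum>a\<in>UNIV. \<Sum>b\<in>UNIV. \<Sum>c\<in>UNIV.
       L $ i $ a * M $ k $ b * N $ h $ c * (w j * A $ a $ j * B $ b $ j * C $ c $ j))" for j
  proof -
    have "w j * (L ** A) $ i $ j * (M ** B) $ k $ j * (N ** C) $ h $ j =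
        w j * ((\<Sum>a\<in>UNIV. L $ i $ a * A $ a $ j) *
          ((\<Sum>b\<in>UNIV. M $ k $ b * B $ b $ j) * (\<Sum>c\<in>UNIV. N $ h $ c * C $ c $ j)))"
      by (simp add: matrix_matrix_mult_def mult.assoc)
    also have "\<dots> = (\<Sum>a\<in>UNIV. \<Sum>b\<in>UNIV. \<Sum>c\<in>UNIV.
        w j * (L $ i $ a * A $ a $ j * (M $ k $ b * B $ b $ j * (N $ h $ c * C $ c $ j))))"
      unfolding sum_product3 unfolding sum_distrib_left ..
    finally show ?thesis
      by (simp only: mult_ac)
  qed
  then have "three_way_array w (L ** A) (M ** B) (N ** C) $ i $ k $ h =
    (\<Sum>j\<in>UNIV. \<Sum>a\<in>UNIV. \<Sum>b\<in>UNIV. \<Sum>c\<in>UNIV.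
       L $ i $ a * M $ k $ b * N $ h $ c * (w j * A $ a $ j * B $ b $ j * C $ c $ j))"
    by (simp only: three_way_array_nth)
  also have "\<dots> = (\<Sum>a\<in>UNIV. \<Sum>j\<in>UNIV. \<Sum>b\<in>UNIV. \<Sum>c\<in>UNIV.
       L $ i $ a * M $ k $ b * N $ h $ c * (w j * A $ a $ j * B $ b $ j * C $ c $ j))"
    by (rule sum.swap)
  also have "\<dots> = (\<Sum>a\<in>UNIV. \<Sum>b\<in>UNIV. \<Sum>j\<in>UNIV. \<Sum>c\<in>UNIV.
       L $ i $ a * M $ k $ b * N $ h $ c * (w j * A $ a $ j * B $ b $ j * C $ c $ j))"
    by (rule sum.cong[OF refl], rule sum.swap)
  also have "\<dots> = (\<Sum>a\<in>UNIV. \<Sum>b\<in>UNIV. \<Sum>c\<in>UNIV. \<Sum>j\<in>UNIV.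
       L $ i $ a * M $ k $ b * N $ h $ c * (w j * A $ a $ j * B $ b $ j * C $ c $ j))"
    by (rule sum.cong[OF refl], rule sum.cong[OF refl], rule sum.swap)
  finally show ?thesis
    by (simp only: three_way_array_nth sum_distrib_left)
qed

text \<open>With the array written as \<open>A ** diagonal w ** transpose B\<close>, multiplying by
  \<open>L\<close> on the left and by \<open>transpose M\<close> on the right strips both factors
  from the reference decomposition and leaves only its weights.\<close>

lemma two_way_array_left_inverse:
  assumes "L ** A = mat 1" "M ** B = mat 1"
    and "two_way_array w' A' B' = two_way_array w A B"
  shows "(L ** A') ** diagonal w' ** transpose (M ** B') = diagonal w"
proof -
  have "(L ** A') ** diagonal w' ** transpose (M ** B')
      = L ** two_way_array w' A' B' ** transpose M"
    by (simp add: two_way_array_eq_matrix_mult matrix_transpose_mul matrix_mul_assoc)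
  also have "\<dots> = L ** two_way_array w A B ** transpose M"
    by (simp only: assms(3))
  also have "\<dots> = (L ** A) ** diagonal w ** transpose (M ** B)"
    by (simp add: two_way_array_eq_matrix_mult matrix_transpose_mul matrix_mul_assoc)
  finally show ?thesis
    by (simp add: assms)
qed

text \<open>The columns of \<open>A'\<close> lie in the column space of \<open>A\<close>, with
  coordinates \<open>L ** A'\<close>. Removing only \<open>B\<close> by \<open>transpose M\<close>
  gives \<open>A' ** ?R = A ** diagonal w\<close>. Here \<open>diagonal w\<close> equals
  \<open>(L ** A') ** ?R\<close>, a product of square matrices, so \<open>?R\<close> is invertible
  and cancels.\<close>

lemma two_way_array_factor_eq:
  fixes A A' :: "real^'r^'a" and B B' :: "real^'r^'b"
  assumes "\<And>j. w j \<noteq> 0" "L ** A = mat 1" "M ** B = mat 1"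
    and eq: "two_way_array w' A' B' = two_way_array w A B"
  shows "A' = A ** (L ** A')"
proof -
  let ?R = "diagonal w' ** transpose (M ** B')"
  have W: "(L ** A') ** ?R = diagonal w"
    using two_way_array_left_inverse[OF assms(2-4)] by (simp add: matrix_mul_assoc)
  have "invertible ((L ** A') ** ?R)"
    unfolding W by (rule invertible_diagonal, rule assms)
  then have "invertible ?R"
    by (rule invertible_factors)
  moreover have "A' ** ?R = (A ** (L ** A')) ** ?R"
  proof -
    have "A' ** ?R = two_way_array w' A' B' ** transpose M"
      by (simp add: two_way_array_eq_matrix_mult matrix_transpose_mul matrix_mul_assoc)
    also have "\<dots> = two_way_array w A B ** transpose M"
      by (simp only: eq)
    also have "\<dots> = A ** diagonal w ** transpose (M ** B)"
      by (simp add: two_way_array_eq_matrix_mult matrix_transpose_mul matrix_mul_assoc)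
    also have "\<dots> = A ** ((L ** A') ** ?R)"
      by (simp only: W assms(3) transpose_mat matrix_mul_rid)
    finally show ?thesis
      by (simp add: matrix_mul_assoc)
  qed
  ultimately show ?thesis
    by (rule invertible_mult_right_cancel)
qed

text \<open>For \<open>i = k\<close> the hypothesis makes every entry 0 or 1; for distinct
  \<open>i\<close> and \<open>k\<close> it allows at most one nonzero entry per column. Choosing a
  nonzero position in each row is therefore injective, and bijective by finiteness.\<close>

lemma permutation_matrix_if_idempotent_columns:
  fixes S :: "real^'r^'r"
  assumes mult: "\<And>i k j. S $ i $ j * S $ k $ j = (if i = k then S $ i $ j else 0)"
    and nz: "\<And>i. \<exists>j. S $ i $ j \<noteq> 0"
  shows "permutation_matrix S"
proof -
  obtain g where g: "\<And>i. S $ i $ g i \<noteq> 0"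
    using nz by metis
  have "inj g"
  proof (rule injI, rule ccontr)
    fix i k
    assume "g i = g k" "i \<noteq> k"
    then show False
      using mult[of i "g i" k] g[of i] g[of k] by simp
  qed
  then have "bij g"
    by (simp add: finite_UNIV_inj_surj bij_def)
  \<comment> \<open>\<open>g\<close> sends rows to columns, while \<open>permutation_matrix\<close>
    uses a map from columns to rows; hence \<open>inv g\<close>.\<close>
  have "S $ i $ j = (if i = inv g j then 1 else 0)" for i j
  proof -
    obtain k where j: "j = g k"
      using \<open>bij g\<close> by (metis bij_pointE)
    have "S $ k $ j = 1"
      using g[of k] mult[of k j k] j by simp
    then show ?thesis
      using mult[of i j k] j \<open>inj g\<close> by auto
  qed
  moreover have "inv g permutes UNIV"
    by (rule bij_imp_permutes[OF bij_imp_bij_inv[OF \<open>bij g\<close>]]) simp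
  ultimately show ?thesis
    unfolding permutation_matrix_def by (auto simp: vec_eq_iff)
qed

lemma permutation_matrix_if_moments_diagonal:
  fixes S :: "real^'r^'r"
  assumes w: "\<And>j. w j \<noteq> 0"
    and two: "\<And>i k. (\<Sum>j\<in>UNIV. w' j * S $ i $ j * S $ k $ j) = (if i = k then w i else 0)"
    and three: "\<And>i k l. (\<Sum>j\<in>UNIV. w' j * S $ i $ j * S $ k $ j * S $ l $ j)
                  = (if i = k \<and> k = l then w i else 0)"
  shows "permutation_matrix S"
proof (rule permutation_matrix_if_idempotent_columns)
  have W: "S ** diagonal w' ** transpose S = diagonal w"
    unfolding two_way_array_eq_matrix_mult[symmetric]
    by (simp add: vec_eq_iff two_way_array_nth two diagonal_def)
  have "invertible (S ** diagonal w' ** transpose S)"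
    unfolding W by (rule invertible_diagonal, rule w)
  then have "invertible (S ** diagonal w')"
    by (rule invertible_factors)
  then obtain Q where Q: "Q ** (S ** diagonal w') = mat 1"
    unfolding invertible_def by blast
  fix i k j
  \<comment> \<open>\<open>v\<close> is the defect in the claimed identity for rows \<open>i\<close>
    and \<open>k\<close>. Entry \<open>l\<close> of \<open>(S ** diagonal w') *v v\<close> is a
    third moment minus, if \<open>i = k\<close>, a second moment, and these agree. Invertibility of
    \<open>S ** diagonal w'\<close> then forces \<open>v = 0\<close>.\<close>
  define v where "v = (\<chi> j. S $ i $ j * S $ k $ j - (if i = k then S $ i $ j else 0))"
  have "((S ** diagonal w') *v v) $ l = 0" for l
  proof -
    have "((S ** diagonal w') *v v) $ l = (\<Sum>j\<in>UNIV. S $ l $ j * w' j * v $ j)"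
      by (simp add: matrix_vector_mult_def matrix_mult_diagonal_nth)
    also have "\<dots> = (\<Sum>j\<in>UNIV. w' j * S $ i $ j * S $ k $ j * S $ l $ j)
        - (if i = k then \<Sum>j\<in>UNIV. w' j * S $ i $ j * S $ l $ j else 0)"
      by (simp add: v_def algebra_simps sum_subtractf)
    finally show ?thesis
      by (simp add: two three)
  qed
  then have "(S ** diagonal w') *v v = 0"
    by (simp add: vec_eq_iff)
  then have "v = 0"
    using Q matrix_vector_mul_assoc[of Q "S ** diagonal w'" v] by simp
  then have "v $ j = 0"
    by simp
  then show "S $ i $ j * S $ k $ j = (if i = k then S $ i $ j else 0)"
    by (simp add: v_def)
next
  fix i
  show "\<exists>j. S $ i $ j \<noteq> 0"
  proof (rule ccontr)
    \<comment> \<open>A zero row would make its second moment vanish, but that moment is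
      \<open>w i\<close>.\<close>
    assume "\<not> ?thesis"
    then show False
      using two[of i i] w[of i] by simp
  qed
qed

theorem theorem2:
  fixes w w' :: "'r::finite \<Rightarrow> real"
    and X1 X1' :: "real^'r^'k1"
    and X2 X2' :: "real^'r^'k2"
    and X3 X3' :: "real^'r^'k3"
  assumes "\<And>j. w j \<noteq> 0"
    and "rank X1 = CARD('r)" "rank X2 = CARD('r)" "rank X3 = CARD('r)"
    and "\<And>j. w' j \<noteq> 0"
    and "three_way_array w' X1' X2' X3' = three_way_array w X1 X2 X3"
    and "two_way_array w' X1' X2' = two_way_array w X1 X2"
    and "two_way_array w' X1' X3' = two_way_array w X1 X3"
    and "two_way_array w' X2' X3' = two_way_array w X2 X3"
  shows "\<exists>P :: real^'r^'r. permutation_matrix P \<and>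
           X1' = X1 ** P \<and> X2' = X2 ** P \<and> X3' = X3 ** P"
proof -
  note eq12 = assms(7) and eq13 = assms(8) and eq23 = assms(9)
  \<comment> \<open>\<open>two_way_array_factor_eq\<close> recovers the first factor of an array, so
    \<open>X2\<close> and \<open>X3\<close> must also occur in first position.\<close>
  have eq21: "two_way_array w' X2' X1' = two_way_array w X2 X1"
    and eq31: "two_way_array w' X3' X1' = two_way_array w X3 X1"
    and eq32: "two_way_array w' X3' X2' = two_way_array w X3 X2"
    by (simp_all only: two_way_array_commute[of _ X2 X1] two_way_array_commute[of _ X2' X1']
        two_way_array_commute[of _ X3] two_way_array_commute[of _ X3'] eq12 eq13 eq23)
  obtain L where L: "L ** X1 = mat 1"
    using full_column_rank_left_inverse assms(2) .
  obtain M where M: "M ** X2 = mat 1"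
    using full_column_rank_left_inverse assms(3) .
  obtain N where N: "N ** X3 = mat 1"
    using full_column_rank_left_inverse assms(4) .
  define S where "S = L ** X1'"
  define T where "T = M ** X2'"
  define U where "U = N ** X3'"
  have cancel: "A = A'"
    if "A ** diagonal w' ** transpose B = diagonal w" "A' ** diagonal w' ** transpose B = diagonal w"
    for A A' B :: "real^'r^'r"
  proof (rule invertible_mult_right_cancel)
    have "invertible (A ** (diagonal w' ** transpose B))"
      unfolding matrix_mul_assoc that(1) by (rule invertible_diagonal, rule assms)
    then show "invertible (diagonal w' ** transpose B)"
      by (rule invertible_factors)
    show "A ** (diagonal w' ** transpose B) = A' ** (diagonal w' ** transpose B)"
      using that by (simp add: matrix_mul_assoc)
  qed
  \<comment> \<open>Both matrices are paired with the same third one, \<open>U\<close>, and each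
    pairing yields \<open>diagonal w\<close>. The next equality pairs \<open>S\<close> and
    \<open>U\<close> with \<open>T\<close> in the same way.\<close>
  have "S = T"
    using two_way_array_left_inverse[OF L N eq13] two_way_array_left_inverse[OF M N eq23]
    unfolding S_def T_def by (rule cancel)
  have "S = U"
    using two_way_array_left_inverse[OF L M eq12] two_way_array_left_inverse[OF N M eq32]
    unfolding S_def U_def by (rule cancel)
  have X: "X1' = X1 ** S" "X2' = X2 ** T" "X3' = X3 ** U"
    unfolding S_def T_def U_def
    using two_way_array_factor_eq[OF assms(1) L M eq12] two_way_array_factor_eq[OF assms(1) M L eq21]
      two_way_array_factor_eq[OF assms(1) N L eq31] by blast+
  have "permutation_matrix S"
  proof (rule permutation_matrix_if_moments_diagonal[OF assms(1)])
    fix i k l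
    have "two_way_array w' S T $ i $ k = diagonal w $ i $ k"
      unfolding two_way_array_eq_matrix_mult S_def T_def
      by (simp only: two_way_array_left_inverse[OF L M eq12])
    then show "(\<Sum>j\<in>UNIV. w' j * S $ i $ j * S $ k $ j) = (if i = k then w i else 0)"
      by (simp add: two_way_array_nth diagonal_def flip: \<open>S = T\<close>)
    have "three_way_array w' S T U $ i $ k $ l
        = three_way_array w (L ** X1) (M ** X2) (N ** X3) $ i $ k $ l"
      by (simp add: S_def T_def U_def three_way_array_matrix_mult assms(6))
    \<comment> \<open>All three factors are now identity matrices, so the term for \<open>j\<close>
      survives only if \<open>i\<close>, \<open>k\<close> and \<open>l\<close> all equal
      \<open>j\<close>.\<close>
    also have "\<dots> = (if i = k \<and> k = l then w i else 0)"
      unfolding L M N three_way_array_nth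
      by (auto simp: mat_def if_distrib[of "\<lambda>x. _ * x"] cong: if_cong)
    finally show "(\<Sum>j\<in>UNIV. w' j * S $ i $ j * S $ k $ j * S $ l $ j)
        = (if i = k \<and> k = l then w i else 0)"
      using \<open>S = T\<close> \<open>S = U\<close> by (simp add: three_way_array_nth)
  qed
  then show ?thesis
    using X \<open>S = T\<close> \<open>S = U\<close> by blast
qed

end
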